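(* Consider the following 2-dimensional complex GD algebras with basis $e_1,e_2$ (brackets and products not displayed are zero, up to skew-symmetry of the bracket): - $T1(0)$: all operations zero. - $T1(1)$: $[e_1,e_2]=e_1$. - $T2(0)$: $e_2\circ e_2=e_1$. - $T2(1)$: $[e_1,e_2]=e_1$; $e_2\circ e_2=e_1$. - $T3_r$ ($r\in\mathbb C$): $[e_1,e_2]=re_1$; $e_2\circ e_1=-e_1$. - $N1$: $e_1\circ e_1=e_1$, $e_2\circ e_2=e_2$. - $N2$: $e_2\circ e_2=e_2$. - $N3_r$ ($r\in\mathbb C$): $[e_1,e_2]=re_1$; $e_1\circ e_2=e_1$, $e_2\circ e_1=e_1$, $e_2\circ e_2=e_2$. - $N4_r$ ($r\in\mathbb C$): $[e_1,e_2]=re_1$; $e_1\circ e_2=e_1$, $e_2\circ e_2=e_2$. - $N5_r$ ($r\in\mathbb C$): $[e_1,e_2]=re_1$; $e_1\circ e_2=e_1$, $e_2\circ e_2=e_1+e_2$. - $N6_{\ell,r}$ ($\ell\in\mathbb C\setminus\{0,1\}$, $r\in\mathbb C$): $[e_1,e_2]=re_1$; $e_1\circ e_2=e_1$, $e_2\circ e_1=\ell e_1$, $e_2\circ e_2=e_2$. Among these, the nilpotent ones are exactly $T1(0)$ and $T2(0)$, and the solvable ones are exactly $T1(0)$, $T1(1)$, $T2(0)$, $T2(1)$ and $T3_r$ ($r\in\mathbb C$).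
   Context: A Novikov algebra is a vector space with a bilinear product $\circ$ satisfying $(x\circ y)\circ z-x\circ(y\circ z)=(y\circ x)\circ z-y\circ(x\circ z)$ and $(x\circ y)\circ z=(x\circ z)\circ y$. A Gelfand--Dorfman (GD) algebra is a triple $(A,\circ,[\cdot,\cdot])$ such that $(A,\circ)$ is a Novikov algebra, $(A,[\cdot,\cdot])$ is a Lie algebra, and for all $x,y,z\in A$: $[x,y\circ z]-[z,y\circ x]+[y,x]\circ z-[y,z]\circ x-y\circ[x,z]=0$. $A$ is solvable if $A^{(N)}=0$ for some $N\ge0$, where $A^{(0)}=A$, $A^{(n+1)}=A^{(n)}\circ A^{(n)}+[A^{(n)},A^{(n)}]$ (linear spans). $A$ is nilpotent if $A^{\langle N\rangle}=0$ for some $N\ge1$, where $A^{\langle1\rangle}=A$, $A^{\langle n+1\rangle}=\sum_{i=1}^n\bigl(A^{\langle i\rangle}\circ A^{\langle n+1-i\rangle}+[A^{\langle i\rangle},A^{\langle n+1-i\rangle}]\bigr)$. *)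

theory Defs
  imports "HOL-Analysis.Analysis" "HOL-Library.Set_Algebras"
begin

locale bilinear_product = vector_space scale
  for scale :: "'k::field \<Rightarrow> 'a::ab_group_add \<Rightarrow> 'a" +
  fixes mult :: "'a \<Rightarrow> 'a \<Rightarrow> 'a"
  assumes linear_left: "Vector_Spaces.linear scale scale (\<lambda>x. mult x y)"
    and linear_right: "Vector_Spaces.linear scale scale (mult x)"
begin

definition product_span :: "'a set \<Rightarrow> 'a set \<Rightarrow> 'a set" where
  "product_span U V = span {mult u v | u v. u \<in> U \<and> v \<in> V}"

end

locale novikov_algebra = bilinear_product scale nov
  for scale :: "'k::field \<Rightarrow> 'a::ab_group_add \<Rightarrow> 'a"
    and nov :: "'a \<Rightarrow> 'a \<Rightarrow> 'a"  (infixl "\<odot>" 70) +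
  assumes left_symmetric:
      "(x \<odot> y) \<odot> z - x \<odot> (y \<odot> z) = (y \<odot> x) \<odot> z - y \<odot> (x \<odot> z)"
    and right_commutative: "(x \<odot> y) \<odot> z = (x \<odot> z) \<odot> y"

locale lie_algebra = bilinear_product scale lie
  for scale :: "'k::field \<Rightarrow> 'a::ab_group_add \<Rightarrow> 'a"
    and lie :: "'a \<Rightarrow> 'a \<Rightarrow> 'a" +
  assumes alternating: "lie x x = 0"
    and jacobi: "lie x (lie y z) + lie y (lie z x) + lie z (lie x y) = 0"

locale gd_algebra =
    nov: novikov_algebra scale nov + lie: lie_algebra scale lie
  for scale :: "'k::field \<Rightarrow> 'a::ab_group_add \<Rightarrow> 'a"
    and nov :: "'a \<Rightarrow> 'a \<Rightarrow> 'a"  (infixl "\<odot>" 70)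
    and lie :: "'a \<Rightarrow> 'a \<Rightarrow> 'a" +
  assumes compatible:
    "lie x (y \<odot> z) - lie z (y \<odot> x) + lie y x \<odot> z - lie y z \<odot> x - y \<odot> lie x z = 0"
begin

text \<open>Sums of sets, binary and indexed, are the elementwise (Minkowski) sums of
  \<^theory>\<open>HOL-Library.Set_Algebras\<close>, so on subspaces they are the sums of subspaces.\<close>

primrec derived_series :: "nat \<Rightarrow> 'a set" where
  "derived_series 0 = UNIV"
| "derived_series (Suc n) =
     nov.product_span (derived_series n) (derived_series n)
     + lie.product_span (derived_series n) (derived_series n)"

definition solvable :: bool where
  "solvable \<longleftrightarrow> (\<exists>N. derived_series N = {0})"

text \<open>The series starts at index 1; its value at index 0 is irrelevant.\<close>

fun lower_series :: "nat \<Rightarrow> 'a set" where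
  "lower_series 0 = UNIV"
| "lower_series (Suc 0) = UNIV"
| "lower_series (Suc (Suc m)) =
     (\<Sum>i\<in>{1..Suc m}.
        nov.product_span (lower_series i) (lower_series (Suc (Suc m) - i))
        + lie.product_span (lower_series i) (lower_series (Suc (Suc m) - i)))"

definition nilpotent :: bool where
  "nilpotent \<longleftrightarrow> (\<exists>N\<ge>1. lower_series N = {0})"

end

abbreviation e1 :: "complex^2" where "e1 \<equiv> axis 1 1"
abbreviation e2 :: "complex^2" where "e2 \<equiv> axis 2 1"

text \<open>The bilinear operation on \<open>complex^2\<close> whose values on the pairs
  \<open>(e1,e1)\<close>, \<open>(e1,e2)\<close>, \<open>(e2,e1)\<close>, \<open>(e2,e2)\<close> are the first four arguments.\<close>

definition bilinear_ext ::
  "complex^2 \<Rightarrow> complex^2 \<Rightarrow> complex^2 \<Rightarrow> complex^2 \<Rightarrow> complex^2 \<Rightarrow> complex^2 \<Rightarrow> complex^2" where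
  "bilinear_ext u11 u12 u21 u22 x y =
     (x$1 * y$1) *s u11 + (x$1 * y$2) *s u12 + (x$2 * y$1) *s u21 + (x$2 * y$2) *s u22"

text \<open>Labels of the algebras; \<open>T1_0\<close> stands for \<open>T1(0)\<close>, and so on.\<close>

datatype gd2 =
    T1_0 | T1_1 | T2_0 | T2_1 | T3 complex
  | N1 | N2 | N3 complex | N4 complex | N5 complex | N6 complex complex

fun nov2 :: "gd2 \<Rightarrow> complex^2 \<Rightarrow> complex^2 \<Rightarrow> complex^2" where
  "nov2 T1_0 = bilinear_ext 0 0 0 0"
| "nov2 T1_1 = bilinear_ext 0 0 0 0"
| "nov2 T2_0 = bilinear_ext 0 0 0 e1"
| "nov2 T2_1 = bilinear_ext 0 0 0 e1"
| "nov2 (T3 r) = bilinear_ext 0 0 (- e1) 0"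
| "nov2 N1 = bilinear_ext e1 0 0 e2"
| "nov2 N2 = bilinear_ext 0 0 0 e2"
| "nov2 (N3 r) = bilinear_ext 0 e1 e1 e2"
| "nov2 (N4 r) = bilinear_ext 0 e1 0 e2"
| "nov2 (N5 r) = bilinear_ext 0 e1 0 (e1 + e2)"
| "nov2 (N6 l r) = bilinear_ext 0 e1 (l *s e1) e2"

text \<open>\<open>lie_coeff A\<close> is the scalar \<open>c\<close> with \<open>[e1,e2] = c e1\<close>.\<close>

fun lie_coeff :: "gd2 \<Rightarrow> complex" where
  "lie_coeff T1_0 = 0"
| "lie_coeff T1_1 = 1"
| "lie_coeff T2_0 = 0"
| "lie_coeff T2_1 = 1"
| "lie_coeff (T3 r) = r"
| "lie_coeff N1 = 0"
| "lie_coeff N2 = 0"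
| "lie_coeff (N3 r) = r"
| "lie_coeff (N4 r) = r"
| "lie_coeff (N5 r) = r"
| "lie_coeff (N6 l r) = r"

definition lie2 :: "gd2 \<Rightarrow> complex^2 \<Rightarrow> complex^2 \<Rightarrow> complex^2" where
  "lie2 A = bilinear_ext 0 (lie_coeff A *s e1) (- (lie_coeff A *s e1)) 0"

definition gd2_list :: "gd2 set" where
  "gd2_list = {T1_0, T1_1, T2_0, T2_1, N1, N2}
     \<union> range T3 \<union> range N3 \<union> range N4 \<union> range N5
     \<union> {N6 l r | l r. l \<notin> {0, 1}}"

end

theory Submission
  imports Defs
begin

text \<open>In coordinates the defining identities are polynomial identities, checked algebra by algebra.

  Let \<open>L\<close> be the line spanned by \<open>e1\<close>. For the \<open>T\<close> algebras both operations take values in \<open>L\<close>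
  and vanish on \<open>L \<times> L\<close>, so the derived
  series stops after two steps (\<open>solvable_if_metabelian\<close>). In \<open>T1(0)\<close> and \<open>T2(0)\<close> the line \<open>L\<close> is
  even annihilated by the whole algebra, so the lower series stops as well
  (\<open>nilpotent_if_products_annihilate\<close>). In \<open>T1(1)\<close>, \<open>T2(1)\<close> and \<open>T3\<close> the element \<open>e2\<close> acts on \<open>L\<close> by
  a nonzero scalar through the bracket or through the product, and then \<open>e1\<close> survives in every
  term of the lower series (\<open>subset_lower_series\<close>).

  For the \<open>N\<close> algebras some nonzero set is contained in the span of its own Novikov products and
  therefore in all terms of the derived series (\<open>subset_derived_series\<close>). In all of them but \<open>N5\<close>
  this set is the idempotent \<open>e2\<close>. The algebra \<open>N5\<close> has no nonzero idempotent, but there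
  \<open>e1 = e1 \<circ> e2\<close> and \<open>e2 = e2 \<circ> e2 - e1 \<circ> e2\<close>, so the basis is such a set. The same sets survive in
  the lower series.\<close>

section \<open>Spans of products\<close>

lemma set_plus_mono_left: "0 \<in> T \<Longrightarrow> S \<subseteq> S + (T :: 'a::comm_monoid_add set)"
  using set_plus_intro[of _ S 0 T] by fastforce

lemma set_plus_mono_right: "0 \<in> S \<Longrightarrow> T \<subseteq> (S :: 'a::comm_monoid_add set) + T"
  using set_plus_intro[of 0 S _ T] by fastforce

lemma zero_in_sum_sets:
  fixes S :: "'i \<Rightarrow> 'a::comm_monoid_add set"
  assumes "\<And>i. i \<in> I \<Longrightarrow> 0 \<in> S i"
  shows "0 \<in> (\<Sum>i\<in>I. S i)"
  using assms
proof (induction I rule: infinite_finite_induct)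
  case (insert i I)
  then show ?case
    using set_plus_intro[of 0 "S i" 0] by simp
qed auto

lemma subset_sum_sets:
  fixes S :: "'i \<Rightarrow> 'a::comm_monoid_add set"
  assumes "finite I" "j \<in> I" "\<And>i. i \<in> I \<Longrightarrow> 0 \<in> S i"
  shows "S j \<subseteq> (\<Sum>i\<in>I. S i)"
proof -
  have "0 \<in> (\<Sum>i\<in>I - {j}. S i)"
    using assms(3) by (intro zero_in_sum_sets) auto
  then show ?thesis
    using assms(1,2) set_plus_mono_left by (simp add: sum.remove)
qed

context bilinear_product
begin

lemma zero_in_product_span: "0 \<in> product_span U V"
  by (simp add: product_span_def span_zero)

lemma product_span_mono: "U \<subseteq> U' \<Longrightarrow> V \<subseteq> V' \<Longrightarrow> product_span U V \<subseteq> product_span U' V'"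
  unfolding product_span_def by (rule span_mono) blast

lemma product_span_subset:
  assumes "subspace L" "\<And>u v. u \<in> U \<Longrightarrow> v \<in> V \<Longrightarrow> mult u v \<in> L"
  shows "product_span U V \<subseteq> L"
  unfolding product_span_def using assms by (intro span_minimal) auto

lemma product_span_eq_0:
  assumes "\<And>u v. u \<in> U \<Longrightarrow> v \<in> V \<Longrightarrow> mult u v = 0"
  shows "product_span U V = {0}"
  using product_span_subset[of "{0}" U V] assms zero_in_product_span by auto

lemma mult_in_product_span: "u \<in> U \<Longrightarrow> v \<in> V \<Longrightarrow> mult u v \<in> product_span U V"
  unfolding product_span_def by (blast intro: span_base)

lemma subspace_product_span: "subspace (product_span U V)"
  unfolding product_span_def by (rule subspace_span)

end

section \<open>Criteria for solvability and nilpotency\<close>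

context gd_algebra
begin

lemma product_spans_subset:
  assumes "nov.subspace L"
    and "\<And>u v. u \<in> U \<Longrightarrow> v \<in> V \<Longrightarrow> u \<odot> v \<in> L"
    and "\<And>u v. u \<in> U \<Longrightarrow> v \<in> V \<Longrightarrow> lie u v \<in> L"
  shows "nov.product_span U V + lie.product_span U V \<subseteq> L"
proof
  fix x assume "x \<in> nov.product_span U V + lie.product_span U V"
  then obtain a b where "x = a + b" "a \<in> nov.product_span U V" "b \<in> lie.product_span U V"
    by (auto elim: set_plus_elim)
  then show "x \<in> L"
    using assms nov.product_span_subset[of L U V] lie.product_span_subset[of L U V]
    by (auto intro!: nov.subspace_add)
qed

lemma product_spans_eq_0:
  assumes "\<And>u v. u \<in> U \<Longrightarrow> v \<in> V \<Longrightarrow> u \<odot> v = 0"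
    and "\<And>u v. u \<in> U \<Longrightarrow> v \<in> V \<Longrightarrow> lie u v = 0"
  shows "nov.product_span U V + lie.product_span U V = {0}"
  using assms by (simp add: nov.product_span_eq_0 lie.product_span_eq_0 set_plus_def)

lemma solvable_if_metabelian:
  assumes L: "nov.subspace L"
    and into: "\<And>x y. x \<odot> y \<in> L" "\<And>x y. lie x y \<in> L"
    and abelian: "\<And>x y. x \<in> L \<Longrightarrow> y \<in> L \<Longrightarrow> x \<odot> y = 0"
      "\<And>x y. x \<in> L \<Longrightarrow> y \<in> L \<Longrightarrow> lie x y = 0"
  shows solvable
proof -
  have "derived_series 1 \<subseteq> L"
    using product_spans_subset[OF L, of UNIV UNIV] into by simp
  then have "derived_series (Suc 1) = {0}"
    unfolding derived_series.simps(2)[of 1] using abelian by (intro product_spans_eq_0) blast+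
  then show ?thesis
    unfolding solvable_def by blast
qed

lemma nilpotent_if_products_annihilate:
  assumes L: "nov.subspace L"
    and into: "\<And>x y. x \<odot> y \<in> L" "\<And>x y. lie x y \<in> L"
    and annihilate: "\<And>x y. x \<in> L \<Longrightarrow> x \<odot> y = 0" "\<And>x y. x \<in> L \<Longrightarrow> y \<odot> x = 0"
      "\<And>x y. x \<in> L \<Longrightarrow> lie x y = 0" "\<And>x y. x \<in> L \<Longrightarrow> lie y x = 0"
  shows nilpotent
proof -
  have sub: "lower_series 2 \<subseteq> L"
    using product_spans_subset[OF L, of UNIV UNIV] into by (simp add: numeral_2_eq_2)
  have "lower_series 3 =
      (nov.product_span UNIV (lower_series 2) + lie.product_span UNIV (lower_series 2)) +
      (nov.product_span (lower_series 2) UNIV + lie.product_span (lower_series 2) UNIV)"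
    by (simp add: eval_nat_numeral atLeastAtMostSuc_conv add.commute)
  also have "\<dots> = {0} + {0}"
    using sub annihilate by (intro arg_cong2[where f = "(+)"] product_spans_eq_0) auto
  finally have "lower_series 3 = {0}"
    by (simp add: set_plus_def)
  then show ?thesis
    unfolding nilpotent_def by (intro exI[of _ 3]) simp
qed

lemma subset_derived_series:
  assumes "B \<subseteq> nov.product_span B B"
  shows "B \<subseteq> derived_series n"
proof (induction n)
  case (Suc n)
  have "B \<subseteq> nov.product_span (derived_series n) (derived_series n)"
    using assms nov.product_span_mono[OF Suc Suc] by blast
  also have "\<dots> \<subseteq> derived_series (Suc n)"
    by (simp add: set_plus_mono_left lie.zero_in_product_span)
  finally show ?case .
qed simp

text \<open>The summand with index \<open>i = 1\<close> multiplies the previous term by the whole algebra, so it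
  suffices that \<open>B\<close> is recovered from itself by multiplying with arbitrary elements.\<close>

lemma subset_lower_series:
  assumes "B \<subseteq> nov.product_span UNIV B + lie.product_span UNIV B"
  shows "B \<subseteq> lower_series n"
proof (induction n rule: lower_series.induct)
  case (3 m)
  define S where "S i = nov.product_span (lower_series i) (lower_series (Suc (Suc m) - i))
    + lie.product_span (lower_series i) (lower_series (Suc (Suc m) - i))" for i
  have prev: "B \<subseteq> lower_series (Suc m)"
    using "3.IH"(2)[of 1] by simp
  have "B \<subseteq> S 1"
    using assms set_plus_mono2[OF nov.product_span_mono lie.product_span_mono,
        OF subset_refl prev subset_refl prev]
    by (auto simp: S_def)
  also have "\<dots> \<subseteq> (\<Sum>i\<in>{1..Suc m}. S i)"
  proof (rule subset_sum_sets)
    show "0 \<in> S i" for i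
      using set_plus_intro[OF nov.zero_in_product_span lie.zero_in_product_span]
      by (force simp: S_def)
  qed auto
  finally show ?case
    by (simp add: S_def)
qed simp_all

lemma not_solvable_if_self_generating:
  assumes "B \<subseteq> nov.product_span B B" "b \<in> B" "b \<noteq> 0"
  shows "\<not> solvable"
  using subset_derived_series[OF assms(1)] assms(2,3) unfolding solvable_def by blast

lemma not_nilpotent_if_self_reproducing:
  assumes "B \<subseteq> nov.product_span UNIV B + lie.product_span UNIV B" "b \<in> B" "b \<noteq> 0"
  shows "\<not> nilpotent"
  using subset_lower_series[OF assms(1)] assms(2,3) unfolding nilpotent_def by blast

lemma not_nilpotent_if_self_generating:
  assumes "B \<subseteq> nov.product_span B B" "b \<in> B" "b \<noteq> 0"
  shows "\<not> nilpotent"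
proof (rule not_nilpotent_if_self_reproducing)
  have "nov.product_span B B \<subseteq> nov.product_span UNIV B"
    by (intro nov.product_span_mono) auto
  also have "\<dots> \<subseteq> nov.product_span UNIV B + lie.product_span UNIV B"
    by (simp add: set_plus_mono_left lie.zero_in_product_span)
  finally show "B \<subseteq> nov.product_span UNIV B + lie.product_span UNIV B"
    using assms(1) by blast
qed fact+

lemma not_nilpotent_if_nov_eigenvector:
  assumes "y \<odot> x = x" "x \<noteq> 0"
  shows "\<not> nilpotent"
proof (rule not_nilpotent_if_self_reproducing)
  have "x \<in> nov.product_span UNIV {x}"
    using nov.mult_in_product_span[of y UNIV x "{x}"] assms(1) by simp
  then show "{x} \<subseteq> nov.product_span UNIV {x} + lie.product_span UNIV {x}"
    using set_plus_mono_left[OF lie.zero_in_product_span] by blast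
qed (use assms in auto)

lemma not_nilpotent_if_lie_eigenvector:
  assumes "lie y x = x" "x \<noteq> 0"
  shows "\<not> nilpotent"
proof (rule not_nilpotent_if_self_reproducing)
  have "x \<in> lie.product_span UNIV {x}"
    using lie.mult_in_product_span[of y UNIV x "{x}"] assms(1) by simp
  then show "{x} \<subseteq> nov.product_span UNIV {x} + lie.product_span UNIV {x}"
    using set_plus_mono_right[OF nov.zero_in_product_span] by blast
qed (use assms in auto)

lemma not_solvable_if_idempotent:
  assumes "x \<odot> x = x" "x \<noteq> 0"
  shows "\<not> solvable"
  using not_solvable_if_self_generating[of "{x}" x]
    nov.mult_in_product_span[of x "{x}" x "{x}"] assms by simp

end

section \<open>The two-dimensional algebras\<close>

lemmas coordinates = bilinear_ext_def lie2_def vec_eq_iff forall_2 axis_def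

lemma axes_nonzero: "e1 \<noteq> 0" "e2 \<noteq> 0"
  by (auto simp: coordinates)

lemma bilinear_product_bilinear_ext: "bilinear_product (*s) (bilinear_ext u11 u12 u21 u22)"
  by unfold_locales
    (auto simp: bilinear_ext_def vec_eq_iff forall_2 algebra_simps)

lemma lie_algebra_lie2: "lie_algebra (*s) (lie2 A)"
proof -
  interpret bilinear_product "(*s)" "lie2 A"
    unfolding lie2_def by (rule bilinear_product_bilinear_ext)
  show ?thesis
    by unfold_locales (auto simp: coordinates algebra_simps)
qed

lemma novikov_algebra_nov2: "novikov_algebra (*s) (nov2 A)"
proof -
  interpret bilinear_product "(*s)" "nov2 A"
    by (cases A) (simp_all add: bilinear_product_bilinear_ext)
  show ?thesis
    by unfold_locales (cases A; auto simp: coordinates algebra_simps)+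
qed

lemma gd_algebra_nov2_lie2: "gd_algebra (*s) (nov2 A) (lie2 A)"
proof -
  interpret nov: novikov_algebra "(*s)" "nov2 A"
    by (rule novikov_algebra_nov2)
  interpret lie: lie_algebra "(*s)" "lie2 A"
    by (rule lie_algebra_lie2)
  show ?thesis
    by unfold_locales (cases A; auto simp: coordinates algebra_simps)
qed

abbreviation e1_line :: "(complex^2) set" where "e1_line \<equiv> {x. x $ 2 = 0}"

lemma subspace_e1_line: "vec.subspace e1_line"
  by (auto simp: vec.subspace_def)

lemma solvable_T:
  assumes "A \<in> {T1_0, T1_1, T2_0, T2_1} \<union> range T3"
  shows "gd_algebra.solvable (*s) (nov2 A) (lie2 A)"
  by (rule gd_algebra.solvable_if_metabelian[OF gd_algebra_nov2_lie2 subspace_e1_line])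
    (use assms in \<open>auto simp: coordinates\<close>)

lemma nilpotent_T1_0_T2_0:
  assumes "A \<in> {T1_0, T2_0}"
  shows "gd_algebra.nilpotent (*s) (nov2 A) (lie2 A)"
  by (rule gd_algebra.nilpotent_if_products_annihilate[OF gd_algebra_nov2_lie2 subspace_e1_line])
    (use assms in \<open>auto simp: coordinates\<close>)

text \<open>As \<open>[e2,e1] = - e1\<close> in \<open>T1(1)\<close> and \<open>T2(1)\<close>, and \<open>e2 \<circ> e1 = - e1\<close> in \<open>T3\<close>, the operator that
  fixes \<open>e1\<close> is left multiplication by \<open>- e2\<close>.\<close>

lemma not_nilpotent_T:
  assumes "A \<in> {T1_1, T2_1} \<union> range T3"
  shows "\<not> gd_algebra.nilpotent (*s) (nov2 A) (lie2 A)"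
proof (cases "A \<in> range T3")
  case True
  then have "nov2 A (- e2) e1 = e1"
    by (auto simp: coordinates)
  then show ?thesis
    using gd_algebra.not_nilpotent_if_nov_eigenvector[OF gd_algebra_nov2_lie2] axes_nonzero
    by blast
next
  case False
  then have "lie2 A (- e2) e1 = e1"
    using assms by (auto simp: coordinates)
  then show ?thesis
    using gd_algebra.not_nilpotent_if_lie_eigenvector[OF gd_algebra_nov2_lie2] axes_nonzero
    by blast
qed

lemma idempotent_e2:
  assumes "A \<in> {N1, N2} \<union> range N3 \<union> range N4 \<union> range (case_prod N6)"
  shows "nov2 A e2 e2 = e2"
  using assms by (auto simp: coordinates)

lemma N5_self_generating:
  "{e1, e2} \<subseteq> bilinear_product.product_span (*s) (nov2 (N5 r)) {e1, e2} {e1, e2}"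
proof -
  interpret bilinear_product "(*s)" "nov2 (N5 r)"
    by (simp add: bilinear_product_bilinear_ext)
  let ?P = "product_span {e1, e2} {e1, e2}"
  have e1: "nov2 (N5 r) e1 e2 = e1" and e2: "nov2 (N5 r) e2 e2 - nov2 (N5 r) e1 e2 = e2"
    by (auto simp: coordinates)
  have "nov2 (N5 r) e1 e2 \<in> ?P" "nov2 (N5 r) e2 e2 \<in> ?P"
    by (rule mult_in_product_span; blast)+
  then have "nov2 (N5 r) e1 e2 \<in> ?P" "nov2 (N5 r) e2 e2 - nov2 (N5 r) e1 e2 \<in> ?P"
    by (simp_all only: vec.subspace_diff[OF subspace_product_span])
  then have "e1 \<in> ?P" "e2 \<in> ?P"
    unfolding e2 unfolding e1 by this+
  then show ?thesis
    by simp
qed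

lemma N_neither_solvable_nor_nilpotent:
  assumes "A \<in> {N1, N2} \<union> range N3 \<union> range N4 \<union> range N5 \<union> range (case_prod N6)"
  shows "\<not> gd_algebra.solvable (*s) (nov2 A) (lie2 A)"
    and "\<not> gd_algebra.nilpotent (*s) (nov2 A) (lie2 A)"
proof -
  interpret gd_algebra "(*s)" "nov2 A" "lie2 A"
    by (rule gd_algebra_nov2_lie2)
  have "\<not> solvable \<and> \<not> nilpotent"
  proof (cases "A \<in> range N5")
    case True
    then have "{e1, e2} \<subseteq> nov.product_span {e1, e2} {e1, e2}"
      using N5_self_generating by blast
    then show ?thesis
      using not_solvable_if_self_generating not_nilpotent_if_self_generating axes_nonzero
      by blast
  next
    case False
    then have "nov2 A e2 e2 = e2"
      using assms by (intro idempotent_e2) auto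
    then show ?thesis
      using not_solvable_if_idempotent not_nilpotent_if_nov_eigenvector axes_nonzero by blast
  qed
  then show "\<not> solvable" "\<not> nilpotent"
    by auto
qed

theorem proposition7p13:
  shows "(\<forall>A\<in>gd2_list. gd_algebra (*s) (nov2 A) (lie2 A))
    \<and> {A \<in> gd2_list. gd_algebra.nilpotent (*s) (nov2 A) (lie2 A)} = {T1_0, T2_0}
    \<and> {A \<in> gd2_list. gd_algebra.solvable (*s) (nov2 A) (lie2 A)}
        = {T1_0, T1_1, T2_0, T2_1} \<union> range T3"
proof (intro conjI)
  have gd2_list_cases: "A \<in> gd2_list \<Longrightarrow> A \<in> {T1_0, T2_0} \<or> A \<in> {T1_1, T2_1} \<union> range T3
      \<or> A \<in> {N1, N2} \<union> range N3 \<union> range N4 \<union> range N5 \<union> range (case_prod N6)" for A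
    by (auto simp: gd2_list_def)
  have T_subset: "{T1_0, T1_1, T2_0, T2_1} \<union> range T3 \<subseteq> gd2_list"
    by (auto simp: gd2_list_def)
  show "\<forall>A\<in>gd2_list. gd_algebra (*s) (nov2 A) (lie2 A)"
    by (simp add: gd_algebra_nov2_lie2)
  show "{A \<in> gd2_list. gd_algebra.nilpotent (*s) (nov2 A) (lie2 A)} = {T1_0, T2_0}"
  proof (intro equalityI subsetI)
    fix A assume "A \<in> {A \<in> gd2_list. gd_algebra.nilpotent (*s) (nov2 A) (lie2 A)}"
    then have "A \<in> gd2_list" "gd_algebra.nilpotent (*s) (nov2 A) (lie2 A)"
      by simp_all
    then show "A \<in> {T1_0, T2_0}"
      using gd2_list_cases[of A] not_nilpotent_T[of A] N_neither_solvable_nor_nilpotent(2)[of A]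
      by argo
  next
    fix A assume A: "A \<in> {T1_0, T2_0}"
    then have "A \<in> gd2_list"
      using T_subset by blast
    with A show "A \<in> {A \<in> gd2_list. gd_algebra.nilpotent (*s) (nov2 A) (lie2 A)}"
      by (simp only: mem_Collect_eq nilpotent_T1_0_T2_0 simp_thms)
  qed
  show "{A \<in> gd2_list. gd_algebra.solvable (*s) (nov2 A) (lie2 A)}
      = {T1_0, T1_1, T2_0, T2_1} \<union> range T3" (is "_ = ?T")
  proof (intro equalityI subsetI)
    fix A assume "A \<in> {A \<in> gd2_list. gd_algebra.solvable (*s) (nov2 A) (lie2 A)}"
    then have "A \<in> gd2_list" "gd_algebra.solvable (*s) (nov2 A) (lie2 A)"
      by simp_all
    then have "A \<in> {T1_0, T2_0} \<or> A \<in> {T1_1, T2_1} \<union> range T3"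
      using gd2_list_cases[of A] N_neither_solvable_nor_nilpotent(1)[of A] by argo
    then show "A \<in> ?T"
      by blast
  next
    fix A assume A: "A \<in> ?T"
    then have "A \<in> gd2_list"
      using T_subset by blast
    with A show "A \<in> {A \<in> gd2_list. gd_algebra.solvable (*s) (nov2 A) (lie2 A)}"
      by (simp only: mem_Collect_eq solvable_T simp_thms)
  qed
qed

end
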